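(* Let $S$ be a semiring and let $\Lambda,\Delta$ be two index sets such that $\Lambda\cup\Delta\neq\emptyset$. Then the following statements are equivalent: (1) $c(fg)\subseteq c(f)c(g)\subseteq\sqrt{c(fg)}$ for all $f,g\in S[X_\Lambda,{X_\Delta}^{-1}]$; (2) $\sqrt{I}$ is subtractive for each ideal $I$ of $S$; (3) each prime ideal $\mathbf{p}$ of $S$ is subtractive.
   Context: A semiring $(S,+,\cdot,0,1)$ is commutative: $(S,+,0)$ and $(S,\cdot,1)$ are commutative monoids, $1\neq 0$, multiplication distributes over addition, and $s\cdot 0=0$ for all $s$. An ideal is a nonempty subset closed under addition and under multiplication by elements of $S$. A prime ideal is an ideal $P\neq S$ such that $ab\in P$ implies $a\in P$ or $b\in P$. An ideal $I$ is subtractive if for all $a,b\in S$, $a+b\in I$ and $a\in I$ imply $b\in I$. $\sqrt{I}=\{s\in S: s^n\in I\text{ for some positive integer }n\}$. The product $IJ$ of ideals is the set of finite sums of products $ab$ with $a\in I$, $b\in J$. $S[X_\Lambda,{X_\Delta}^{-1}]$ is the union of all the Laurent polynomial semirings $S[X_{\lambda_1},\ldots,X_{\lambda_n},{X_{\delta_1}}^{-1},\ldots,{X_{\delta_m}}^{-1}]$ with $\lambda_i\in\Lambda$, $\delta_j\in\Delta$, i.e. the subsemiring generated by $S$, the $X_\lambda$ ($\lambda\in\Lambda$) and the $X_\delta^{-1}$ ($\delta\in\Delta$) inside the Laurent polynomials over $S$ in commuting indeterminates indexed by $\Lambda\cup\Delta$. For $f$ in it, $c(f)$ is the ideal of $S$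 generated by the coefficients of $f$. *)

theory Defs
  imports Main "HOL-Library.Poly_Mapping"
begin

text \<open>
  A commutative semiring with \<open>1 \<noteq> 0\<close> and \<open>s * 0 = 0\<close> is a type of class \<^class>\<open>comm_semiring_1\<close>.
\<close>

definition sr_ideal :: "'a::comm_semiring_1 set \<Rightarrow> bool" where
  "sr_ideal I \<longleftrightarrow>
     I \<noteq> {} \<and> (\<forall>a\<in>I. \<forall>b\<in>I. a + b \<in> I) \<and> (\<forall>s. \<forall>a\<in>I. s * a \<in> I)"

definition sr_prime_ideal :: "'a::comm_semiring_1 set \<Rightarrow> bool" where
  "sr_prime_ideal P \<longleftrightarrow>
     sr_ideal P \<and> P \<noteq> UNIV \<and> (\<forall>a b. a * b \<in> P \<longrightarrow> a \<in> P \<or> b \<in> P)"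

definition subtractive :: "'a::comm_semiring_1 set \<Rightarrow> bool" where
  "subtractive I \<longleftrightarrow> (\<forall>a b. a + b \<in> I \<and> a \<in> I \<longrightarrow> b \<in> I)"

definition sr_radical :: "'a::comm_semiring_1 set \<Rightarrow> 'a set" where
  "sr_radical I = {s. \<exists>n>0. s ^ n \<in> I}"

definition ideal_generated :: "'a::comm_semiring_1 set \<Rightarrow> 'a set" where
  "ideal_generated A = \<Inter>{I. sr_ideal I \<and> A \<subseteq> I}"

definition ideal_product :: "'a::comm_semiring_1 set \<Rightarrow> 'a set \<Rightarrow> 'a set" where
  "ideal_product I J =
     {\<Sum>k<n. a k * b k | (n::nat) a b. \<forall>k<n. a k \<in> I \<and> b k \<in> J}"

text \<open>
  A Laurent monomial is a finitely supported integer exponent vector, and a Laurent polynomial is a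
  finitely supported assignment of coefficients to such vectors; the multiplication of
  \<^type>\<open>poly_mapping\<close> is convolution.
\<close>

type_synonym ('i, 'a) laurent_poly = "('i \<Rightarrow>\<^sub>0 int) \<Rightarrow>\<^sub>0 'a"

definition laurent_const :: "'a::comm_semiring_1 \<Rightarrow> ('i, 'a) laurent_poly" where
  "laurent_const s = Poly_Mapping.single 0 s"

definition laurent_X :: "'i \<Rightarrow> ('i, 'a::comm_semiring_1) laurent_poly" where
  "laurent_X i = Poly_Mapping.single (Poly_Mapping.single i 1) 1"

definition laurent_X_inv :: "'i \<Rightarrow> ('i, 'a::comm_semiring_1) laurent_poly" where
  "laurent_X_inv i = Poly_Mapping.single (Poly_Mapping.single i (- 1)) 1"

text \<open>
  The subsemiring \<open>S[X\<^sub>\<Lambda>, X\<^sub>\<Delta>\<^sup>-\<^sup>1]\<close>. The index sets may overlap; \<open>X\<^sub>i\<close> is invertible in it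
  exactly if \<open>i \<in> \<Lambda> \<inter> \<Delta>\<close>, and for \<open>i \<in> \<Delta> - \<Lambda>\<close> only nonpositive powers of \<open>X\<^sub>i\<close> occur.
\<close>

inductive_set laurent_semiring ::
    "'i set \<Rightarrow> 'i set \<Rightarrow> ('i, 'a::comm_semiring_1) laurent_poly set"
  for \<Lambda> \<Delta> :: "'i set" where
  const: "laurent_const s \<in> laurent_semiring \<Lambda> \<Delta>"
| X: "i \<in> \<Lambda> \<Longrightarrow> laurent_X i \<in> laurent_semiring \<Lambda> \<Delta>"
| X_inv: "i \<in> \<Delta> \<Longrightarrow> laurent_X_inv i \<in> laurent_semiring \<Lambda> \<Delta>"
| add: "f \<in> laurent_semiring \<Lambda> \<Delta> \<Longrightarrow> g \<in> laurent_semiring \<Lambda> \<Delta> \<Longrightarrow>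
    f + g \<in> laurent_semiring \<Lambda> \<Delta>"
| mult: "f \<in> laurent_semiring \<Lambda> \<Delta> \<Longrightarrow> g \<in> laurent_semiring \<Lambda> \<Delta> \<Longrightarrow>
    f * g \<in> laurent_semiring \<Lambda> \<Delta>"

definition content :: "('i, 'a::comm_semiring_1) laurent_poly \<Rightarrow> 'a set" where
  "content f = ideal_generated (Set.range (Poly_Mapping.lookup f))"

end

theory Submission
  imports Defs
begin

text \<open>
  Everything rests on prime ideals. The radical of an ideal is the intersection of the prime ideals
  above it (\<open>sr_radical_eq_Inter_primes\<close>), subtractivity passes to intersections, and a prime ideal
  is its own radical; so all radicals are subtractive iff all primes are.

  For the content formula, only the inclusion of \<open>c(f)c(g)\<close> in the radical of \<open>c(fg)\<close> has substance,
  and by the same intersection formula it says that a prime \<open>P\<close> containing \<open>c(fg)\<close> contains \<open>c(f)\<close> or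
  \<open>c(g)\<close>. For subtractive \<open>P\<close> this is the proof of Gauss's lemma
  (\<open>content_subset_prime_of_mult\<close>): among the monomials of \<open>f\<close> and of \<open>g\<close> with coefficient
  outside \<open>P\<close> there is a pair \<open>m, n\<close> whose product monomial arises from no other such pair, and
  subtractivity isolates \<open>f\<^sub>m g\<^sub>n\<close> from the coefficient of \<open>fg\<close> at that monomial. Instead of a
  monomial order, which would require an order on the indeterminates, the pair is found by
  maximising the Euclidean norm of the exponent vector \<open>m + n\<close> (\<open>unique_sum_pair\<close>).

  Conversely, if \<open>a\<close> and \<open>a + b\<close> lie in a prime \<open>P\<close>, then all coefficients of
  \<open>(1 + X) (a + b X + a X\<^sup>2) = a + (a + b) X + (a + b) X\<^sup>2 + a X\<^sup>3\<close> lie in \<open>P\<close>, while \<open>b\<close> lies in the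
  product of the contents of the factors. The content formula then puts a power of \<open>b\<close>, hence \<open>b\<close>,
  into \<open>P\<close>.
\<close>

section \<open>Ideals of semirings\<close>

lemma sr_ideal_add: "sr_ideal I \<Longrightarrow> a \<in> I \<Longrightarrow> b \<in> I \<Longrightarrow> a + b \<in> I"
  and sr_ideal_mult_left: "sr_ideal I \<Longrightarrow> a \<in> I \<Longrightarrow> s * a \<in> I"
  by (auto simp: sr_ideal_def)

lemma sr_ideal_mult_right: "sr_ideal I \<Longrightarrow> a \<in> I \<Longrightarrow> a * s \<in> I"
  by (metis sr_ideal_mult_left mult.commute)

lemma sr_ideal_zero: "sr_ideal I \<Longrightarrow> 0 \<in> I"
  unfolding sr_ideal_def by (metis mult_zero_left ex_in_conv)

lemma sr_ideal_sum:
  assumes "sr_ideal I" and "\<And>x. x \<in> A \<Longrightarrow> h x \<in> I"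
  shows "sum h A \<in> I"
  using assms(2)
  by (induction A rule: infinite_finite_induct) (auto simp: assms(1) sr_ideal_zero sr_ideal_add)

lemma sr_ideal_ideal_generated: "sr_ideal (ideal_generated A)"
proof -
  have "0 \<in> ideal_generated A"
    by (auto simp: ideal_generated_def sr_ideal_zero)
  then show ?thesis
    unfolding sr_ideal_def[of "ideal_generated A"]
    by (auto simp: ideal_generated_def sr_ideal_add sr_ideal_mult_left)
qed

lemma ideal_generated_superset: "A \<subseteq> ideal_generated A"
  by (auto simp: ideal_generated_def)

lemma ideal_generated_least: "sr_ideal I \<Longrightarrow> A \<subseteq> I \<Longrightarrow> ideal_generated A \<subseteq> I"
  by (auto simp: ideal_generated_def)

lemma sum_in_ideal_product:
  fixes n :: nat
  assumes "\<And>k. k < n \<Longrightarrow> a k \<in> I \<and> b k \<in> J"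
  shows "(\<Sum>k<n. a k * b k) \<in> ideal_product I J"
  unfolding ideal_product_def using assms by blast

lemma mult_in_ideal_product:
  assumes "a \<in> I" "b \<in> J"
  shows "a * b \<in> ideal_product I J"
  using sum_in_ideal_product[of 1 "\<lambda>_. a" I "\<lambda>_. b" J] assms by simp

lemma sr_ideal_ideal_product:
  assumes I: "sr_ideal I"
  shows "sr_ideal (ideal_product I J)"
  unfolding sr_ideal_def
proof (intro conjI ballI allI)
  have "0 \<in> ideal_product I J"
    using sum_in_ideal_product[of 0] by simp
  then show "ideal_product I J \<noteq> {}" by blast
next
  fix x y assume "x \<in> ideal_product I J" "y \<in> ideal_product I J"
  then obtain n m :: nat and a b c d
    where x: "x = (\<Sum>k<n. a k * b k)" "\<forall>k<n. a k \<in> I \<and> b k \<in> J"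
      and y: "y = (\<Sum>k<m. c k * d k)" "\<forall>k<m. c k \<in> I \<and> d k \<in> J"
    unfolding ideal_product_def by blast
  define p q where "p k = (if k < n then a k else c (k - n))"
    and "q k = (if k < n then b k else d (k - n))" for k
  have "(\<Sum>k<n + m. p k * q k) = (\<Sum>k<n. p k * q k) + (\<Sum>k<m. p (n + k) * q (n + k))"
    by (induction m) (simp_all add: add.assoc)
  then have "x + y = (\<Sum>k<n + m. p k * q k)"
    unfolding x(1) y(1) by (simp add: p_def q_def)
  moreover have "\<forall>k<n + m. p k \<in> I \<and> q k \<in> J"
    using x(2) y(2) by (auto simp: p_def q_def)
  ultimately show "x + y \<in> ideal_product I J"
    by (simp add: sum_in_ideal_product)
next
  fix s x assume "x \<in> ideal_product I J"
  then obtain n :: nat and a b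
    where x: "x = (\<Sum>k<n. a k * b k)" "\<forall>k<n. a k \<in> I \<and> b k \<in> J"
    unfolding ideal_product_def by blast
  have "s * x = (\<Sum>k<n. (s * a k) * b k)"
    by (simp add: x(1) sum_distrib_left mult.assoc)
  moreover have "\<forall>k<n. s * a k \<in> I \<and> b k \<in> J"
    using x(2) I by (auto intro: sr_ideal_mult_left)
  ultimately show "s * x \<in> ideal_product I J"
    by (simp add: sum_in_ideal_product)
qed

lemma ideal_product_subset:
  assumes "sr_ideal K" and "\<And>a b. a \<in> I \<Longrightarrow> b \<in> J \<Longrightarrow> a * b \<in> K"
  shows "ideal_product I J \<subseteq> K"
  unfolding ideal_product_def using assms by (auto intro!: sr_ideal_sum)

section \<open>Radicals as intersections of primes\<close>

lemma sr_prime_ideal_power: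
  assumes P: "sr_prime_ideal P" and "s ^ n \<in> P" "n > 0"
  shows "s \<in> P"
  using assms(2,3)
proof (induction n)
  case (Suc n)
  show ?case
  proof (cases n)
    case 0
    with Suc.prems show ?thesis by simp
  next
    case (Suc k)
    have "s \<in> P \<or> s ^ n \<in> P"
      using Suc.prems(1) P unfolding sr_prime_ideal_def power_Suc by blast
    with Suc.IH Suc show ?thesis by blast
  qed
qed simp

lemma sr_radical_subset_prime:
  assumes "sr_prime_ideal P" "I \<subseteq> P"
  shows "sr_radical I \<subseteq> P"
  using assms sr_prime_ideal_power unfolding sr_radical_def by blast

lemma sr_radical_prime:
  assumes "sr_prime_ideal P"
  shows "sr_radical P = P"
proof
  show "P \<subseteq> sr_radical P"
    unfolding sr_radical_def by (auto intro!: exI[of _ "1::nat"])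
qed (simp add: assms sr_radical_subset_prime)

definition adjoin :: "'a::comm_semiring_1 set \<Rightarrow> 'a \<Rightarrow> 'a set" where
  "adjoin I a = {x + r * a | x r. x \<in> I}"

lemma adjoin:
  assumes I: "sr_ideal I"
  shows sr_ideal_adjoin: "sr_ideal (adjoin I a)"
    and subset_adjoin: "I \<subseteq> adjoin I a"
    and mem_adjoin: "a \<in> adjoin I a"
proof -
  show sub: "I \<subseteq> adjoin I a"
    unfolding adjoin_def by (force intro: exI[of _ 0])
  show "a \<in> adjoin I a"
    unfolding adjoin_def using sr_ideal_zero[OF I] by (force intro: exI[of _ 1])
  show "sr_ideal (adjoin I a)"
    unfolding sr_ideal_def
  proof (intro conjI ballI allI)
    show "adjoin I a \<noteq> {}" using sub sr_ideal_zero[OF I] by blast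
  next
    fix u v assume "u \<in> adjoin I a" "v \<in> adjoin I a"
    then obtain x r y t where "u = x + r * a" "v = y + t * a" "x \<in> I" "y \<in> I"
      unfolding adjoin_def by blast
    then have "u + v = (x + y) + (r + t) * a" "x + y \<in> I"
      by (auto simp: algebra_simps I sr_ideal_add)
    then show "u + v \<in> adjoin I a" unfolding adjoin_def by blast
  next
    fix s u assume "u \<in> adjoin I a"
    then obtain x r where "u = x + r * a" "x \<in> I"
      unfolding adjoin_def by blast
    then have "s * u = s * x + (s * r) * a" "s * x \<in> I"
      by (auto simp: algebra_simps I sr_ideal_mult_left)
    then show "s * u \<in> adjoin I a" unfolding adjoin_def by blast
  qed
qed

text \<open>
  Among the ideals above \<open>I\<close> that contain no power of \<open>s\<close>, a maximal one \<open>M\<close> is prime: if \<open>a\<close> and \<open>b\<close>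
  are outside \<open>M\<close>, then adjoining either to \<open>M\<close> captures a power of \<open>s\<close>, and the product of these two
  powers would lie in \<open>M\<close> if \<open>ab\<close> did.
\<close>

lemma prime_avoiding_powers:
  assumes I: "sr_ideal I" and s: "s \<notin> sr_radical I"
  obtains P where "sr_prime_ideal P" "I \<subseteq> P" "s \<notin> P"
proof -
  define F where "F = {J. sr_ideal J \<and> I \<subseteq> J \<and> s \<notin> sr_radical J}"
  have "I \<in> F" using I s by (simp add: F_def)
  have "\<Union>C \<in> F" if C: "C \<noteq> {}" "subset.chain F C" for C
  proof -
    have CF: "C \<subseteq> F" and total: "\<And>X Y. X \<in> C \<Longrightarrow> Y \<in> C \<Longrightarrow> X \<subseteq> Y \<or> Y \<subseteq> X"
      using C(2) by (auto simp: subset.chain_def)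
    have "sr_ideal (\<Union>C)"
      unfolding sr_ideal_def
    proof (intro conjI ballI allI)
      show "\<Union>C \<noteq> {}" using C(1) CF sr_ideal_zero by (fastforce simp: F_def)
    next
      fix a b assume "a \<in> \<Union>C" "b \<in> \<Union>C"
      then obtain X where "X \<in> C" "a \<in> X" "b \<in> X" using total by blast
      moreover have "sr_ideal X" using \<open>X \<in> C\<close> CF by (auto simp: F_def)
      ultimately show "a + b \<in> \<Union>C" using sr_ideal_add by blast
    next
      fix r a assume "a \<in> \<Union>C"
      then obtain X where "X \<in> C" "a \<in> X" by blast
      moreover have "sr_ideal X" using \<open>X \<in> C\<close> CF by (auto simp: F_def)
      ultimately show "r * a \<in> \<Union>C" using sr_ideal_mult_left by blast
    qed
    moreover have "I \<subseteq> \<Union>C" using C(1) CF by (auto simp: F_def)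
    moreover have "s \<notin> sr_radical (\<Union>C)"
    proof
      assume "s \<in> sr_radical (\<Union>C)"
      then obtain X where "X \<in> C" "s \<in> sr_radical X" unfolding sr_radical_def by blast
      then show False using CF unfolding F_def by blast
    qed
    ultimately show ?thesis by (simp add: F_def)
  qed
  with \<open>I \<in> F\<close> obtain M where "M \<in> F" and max: "\<And>X. X \<in> F \<Longrightarrow> M \<subseteq> X \<Longrightarrow> X = M"
    using subset_Zorn_nonempty[of F] by blast
  then have M: "sr_ideal M" "I \<subseteq> M" "s \<notin> sr_radical M" by (auto simp: F_def)
  have captures: "\<exists>n>0. \<exists>x\<in>M. \<exists>r. s ^ n = x + r * a" if "a \<notin> M" for a
  proof -
    have "adjoin M a \<notin> F"
      using max[of "adjoin M a"] adjoin[OF M(1), of a] that by blast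
    then have "s \<in> sr_radical (adjoin M a)"
      using adjoin[OF M(1), of a] M(2) by (auto simp: F_def)
    then show ?thesis unfolding sr_radical_def adjoin_def by blast
  qed
  have "s \<notin> M" using M(3) unfolding sr_radical_def by (auto dest: spec[of _ "1::nat"])
  moreover have "sr_prime_ideal M"
    unfolding sr_prime_ideal_def
  proof (intro conjI allI impI)
    show "M \<noteq> UNIV" using \<open>s \<notin> M\<close> by blast
    fix a b assume ab: "a * b \<in> M"
    show "a \<in> M \<or> b \<in> M"
    proof (rule ccontr)
      assume "\<not> (a \<in> M \<or> b \<in> M)"
      then obtain m n x y r t where mn: "m > 0" "n > 0" "x \<in> M" "y \<in> M"
        "s ^ m = x + r * a" "s ^ n = y + t * b"
        using captures by metis
      have "s ^ (m + n) = (y + t * b) * x + (r * a) * y + (r * t) * (a * b)"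
        by (simp add: power_add mn algebra_simps)
      also have "\<dots> \<in> M"
        using mn(3,4) ab M(1) by (meson sr_ideal_add sr_ideal_mult_left)
      finally show False using M(3) mn(1) unfolding sr_radical_def by (blast intro: add_pos_pos)
    qed
  qed (fact M(1))
  ultimately show thesis using that M(2) by blast
qed

lemma sr_radical_eq_Inter_primes:
  assumes "sr_ideal I"
  shows "sr_radical I = \<Inter>{P. sr_prime_ideal P \<and> I \<subseteq> P}"
proof
  show "sr_radical I \<subseteq> \<Inter>{P. sr_prime_ideal P \<and> I \<subseteq> P}"
    using sr_radical_subset_prime by blast
  show "\<Inter>{P. sr_prime_ideal P \<and> I \<subseteq> P} \<subseteq> sr_radical I"
    using prime_avoiding_powers[OF assms] by blast
qed

lemma radicals_subtractive_iff_primes_subtractive: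
  "(\<forall>I :: 'a::comm_semiring_1 set. sr_ideal I \<longrightarrow> subtractive (sr_radical I))
     \<longleftrightarrow> (\<forall>P :: 'a set. sr_prime_ideal P \<longrightarrow> subtractive P)"
proof (intro iffI allI impI)
  fix P :: "'a set"
  assume "\<forall>I :: 'a set. sr_ideal I \<longrightarrow> subtractive (sr_radical I)" and P: "sr_prime_ideal P"
  then have "subtractive (sr_radical P)" by (auto simp: sr_prime_ideal_def)
  then show "subtractive P" by (simp add: sr_radical_prime P)
next
  fix I :: "'a set"
  assume sub: "\<forall>P :: 'a set. sr_prime_ideal P \<longrightarrow> subtractive P" and I: "sr_ideal I"
  show "subtractive (sr_radical I)"
    unfolding sr_radical_eq_Inter_primes[OF I] using sub unfolding subtractive_def by blast
qed

section \<open>Contents of products of Laurent polynomials\<close>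

lemma lookup_mult_eq_sum:
  fixes f g :: "'m::monoid_add \<Rightarrow>\<^sub>0 'a::semiring_0"
  shows "Poly_Mapping.lookup (f * g) k
    = (\<Sum>(m, n) \<in> {(m, n) \<in> Poly_Mapping.keys f \<times> Poly_Mapping.keys g. k = m + n}.
        Poly_Mapping.lookup f m * Poly_Mapping.lookup g n)"
proof -
  let ?K = "Poly_Mapping.keys f \<times> Poly_Mapping.keys g"
  have "Poly_Mapping.lookup (f * g) k
      = (\<Sum>(m, n). Poly_Mapping.lookup f m * Poly_Mapping.lookup g n when k = m + n)"
    by (simp add: times_poly_mapping.rep_eq prod_fun_unfold_prod)
  also have "\<dots> = (\<Sum>(m, n) \<in> ?K.
      Poly_Mapping.lookup f m * Poly_Mapping.lookup g n when k = m + n)"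
    by (rule Sum_any.expand_superset) (auto simp: in_keys_iff)
  also have "\<dots> = (\<Sum>(m, n) \<in> {(m, n) \<in> ?K. k = m + n}.
      Poly_Mapping.lookup f m * Poly_Mapping.lookup g n)"
    by (rule sum.mono_neutral_cong_right) auto
  finally show ?thesis .
qed

lemma lookup_in_content: "Poly_Mapping.lookup f k \<in> content f"
  unfolding content_def using ideal_generated_superset by blast

lemma content_subset_iff: "sr_ideal I \<Longrightarrow> content f \<subseteq> I \<longleftrightarrow> (\<forall>k. Poly_Mapping.lookup f k \<in> I)"
  unfolding content_def
  using ideal_generated_least[of I "range (Poly_Mapping.lookup f)"]
    ideal_generated_superset[of "range (Poly_Mapping.lookup f)"]
  by blast

lemma sr_ideal_content: "sr_ideal (content f)"
  unfolding content_def by (rule sr_ideal_ideal_generated)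

lemma content_mult_subset: "content (f * g) \<subseteq> ideal_product (content f) (content g)"
proof -
  have I: "sr_ideal (ideal_product (content f) (content g))"
    by (rule sr_ideal_ideal_product) (rule sr_ideal_content)
  show ?thesis
    unfolding content_subset_iff[OF I] lookup_mult_eq_sum
    by (auto intro!: sr_ideal_sum[OF I] mult_in_ideal_product lookup_in_content)
qed

text \<open>
  Take \<open>m + n\<close> of maximal Euclidean norm. If \<open>m + n = m' + n'\<close>, then \<open>m + n\<close> is the midpoint of the
  competing sums \<open>m + n'\<close> and \<open>m' + n\<close>, and by the parallelogram law one of these has strictly larger
  norm unless they coincide.
\<close>

lemma unique_sum_pair:
  fixes A B :: "('i \<Rightarrow>\<^sub>0 int) set"
  assumes "finite A" "finite B" "A \<noteq> {}" "B \<noteq> {}"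
  obtains m n where "m \<in> A" "n \<in> B"
    "\<And>m' n'. m' \<in> A \<Longrightarrow> n' \<in> B \<Longrightarrow> m' + n' = m + n \<Longrightarrow> m' = m \<and> n' = n"
proof -
  define K where "K = (\<Union>x \<in> A \<union> B. Poly_Mapping.keys x)"
  define Q where "Q x = (\<Sum>i\<in>K. (Poly_Mapping.lookup x i)\<^sup>2)" for x :: "'i \<Rightarrow>\<^sub>0 int"
  have fin: "finite K" using assms by (simp add: K_def)
  let ?R = "(\<lambda>(x, y). Q (x + y)) ` (A \<times> B)"
  have R: "finite ?R" "?R \<noteq> {}" using assms by auto
  obtain m n where mn: "m \<in> A" "n \<in> B" and "Q (m + n) = Max ?R"
    using Max_in[OF R] by auto
  then have max: "Q (m' + n') \<le> Q (m + n)" if "m' \<in> A" "n' \<in> B" for m' n'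
    using Max_ge[OF R(1), of "Q (m' + n')"] that by force
  have "m' = m \<and> n' = n" if m'n': "m' \<in> A" "n' \<in> B" and eq: "m' + n' = m + n" for m' n'
  proof -
    have pointwise: "Poly_Mapping.lookup m' i + Poly_Mapping.lookup n' i
        = Poly_Mapping.lookup m i + Poly_Mapping.lookup n i" for i
      using eq by (metis lookup_add)
    have "(Poly_Mapping.lookup (m + n') i)\<^sup>2 + (Poly_Mapping.lookup (m' + n) i)\<^sup>2
        = 2 * (Poly_Mapping.lookup (m + n) i)\<^sup>2
          + 2 * (Poly_Mapping.lookup m i - Poly_Mapping.lookup m' i)\<^sup>2" for i
    proof -
      have "Poly_Mapping.lookup n' i
          = Poly_Mapping.lookup m i + Poly_Mapping.lookup n i - Poly_Mapping.lookup m' i"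
        using pointwise[of i] by simp
      then show ?thesis
        by (simp only: lookup_add) (simp add: power2_eq_square algebra_simps)
    qed
    then have "Q (m + n') + Q (m' + n)
        = 2 * Q (m + n) + 2 * (\<Sum>i\<in>K. (Poly_Mapping.lookup m i - Poly_Mapping.lookup m' i)\<^sup>2)"
      by (simp add: Q_def sum_distrib_left flip: sum.distrib)
    moreover have "Q (m + n') \<le> Q (m + n)" "Q (m' + n) \<le> Q (m + n)"
      using max mn m'n' by auto
    ultimately have "(\<Sum>i\<in>K. (Poly_Mapping.lookup m i - Poly_Mapping.lookup m' i)\<^sup>2) \<le> 0" by linarith
    then have "(\<Sum>i\<in>K. (Poly_Mapping.lookup m i - Poly_Mapping.lookup m' i)\<^sup>2) = 0"
      by (intro antisym sum_nonneg) auto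
    then have "\<forall>i\<in>K. Poly_Mapping.lookup m i = Poly_Mapping.lookup m' i"
      using fin by (subst (asm) sum_nonneg_eq_0_iff) auto
    moreover have "Poly_Mapping.lookup m i = 0 \<and> Poly_Mapping.lookup m' i = 0" if "i \<notin> K" for i
      using that mn m'n' by (auto simp: K_def in_keys_iff)
    ultimately have "m' = m" by (intro poly_mapping_eqI) metis
    with eq show ?thesis by simp
  qed
  with mn that show thesis by blast
qed

text \<open>
  Every contribution to the coefficient of \<open>fg\<close> at \<open>m + n\<close> other than \<open>f\<^sub>m g\<^sub>n\<close> has a factor in \<open>P\<close>,
  because \<open>(m, n)\<close> is the only pair from \<open>A \<times> B\<close> with this sum. This replaces the choice of leading
  terms, and subtractivity replaces the subtraction, in the classical argument over rings.
\<close>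

lemma content_subset_prime_of_mult:
  assumes P: "sr_prime_ideal P" and sub: "subtractive P" and fg: "content (f * g) \<subseteq> P"
  shows "content f \<subseteq> P \<or> content g \<subseteq> P"
proof (rule ccontr)
  have I: "sr_ideal P" using P by (simp add: sr_prime_ideal_def)
  define A B where "A = {m. Poly_Mapping.lookup f m \<notin> P}"
    and "B = {n. Poly_Mapping.lookup g n \<notin> P}"
  assume "\<not> (content f \<subseteq> P \<or> content g \<subseteq> P)"
  then have "A \<noteq> {}" "B \<noteq> {}" by (auto simp: content_subset_iff[OF I] A_def B_def)
  moreover have AB: "A \<subseteq> Poly_Mapping.keys f" "B \<subseteq> Poly_Mapping.keys g"
    using sr_ideal_zero[OF I] by (auto simp: A_def B_def in_keys_iff)
  then have "finite A" "finite B" by (auto intro: finite_subset)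
  ultimately obtain m n where mn: "m \<in> A" "n \<in> B"
    and unique: "\<And>m' n'. m' \<in> A \<Longrightarrow> n' \<in> B \<Longrightarrow> m' + n' = m + n \<Longrightarrow> m' = m \<and> n' = n"
    using unique_sum_pair by metis
  let ?S = "{(m', n') \<in> Poly_Mapping.keys f \<times> Poly_Mapping.keys g. m + n = m' + n'}"
  let ?h = "\<lambda>(m', n'). Poly_Mapping.lookup f m' * Poly_Mapping.lookup g n'"
  have "finite ?S" by (rule finite_subset[of _ "Poly_Mapping.keys f \<times> Poly_Mapping.keys g"]) auto
  moreover have "(m, n) \<in> ?S" using mn AB by auto
  ultimately have split: "sum ?h ?S = sum ?h (?S - {(m, n)}) 
      + Poly_Mapping.lookup f m * Poly_Mapping.lookup g n"
    using sum.remove[of ?S "(m, n)" ?h] by (simp only: add.commute prod.case)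
  have total: "sum ?h ?S \<in> P"
    using fg unfolding content_subset_iff[OF I] lookup_mult_eq_sum by blast
  have rest: "sum ?h (?S - {(m, n)}) \<in> P"
  proof (rule sr_ideal_sum[OF I])
    fix x assume x_in: "x \<in> ?S - {(m, n)}"
    obtain m' n' where x: "x = (m', n')" by fastforce
    with x_in have "m' + n' = m + n" "\<not> (m' = m \<and> n' = n)" by auto
    then have "m' \<notin> A \<or> n' \<notin> B" using unique by blast
    then show "?h x \<in> P"
      using I x by (auto simp: A_def B_def sr_ideal_mult_left sr_ideal_mult_right)
  qed
  have "Poly_Mapping.lookup f m * Poly_Mapping.lookup g n \<in> P"
    using sub[unfolded subtractive_def, rule_format, OF conjI, OF total[unfolded split] rest] .
  then show False using mn P by (auto simp: A_def B_def sr_prime_ideal_def)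
qed

lemma ideal_product_content_subset_radical:
  fixes f g :: "('i, 'a::comm_semiring_1) laurent_poly"
  assumes "\<And>P :: 'a set. sr_prime_ideal P \<Longrightarrow> subtractive P"
  shows "ideal_product (content f) (content g) \<subseteq> sr_radical (content (f * g))"
  unfolding sr_radical_eq_Inter_primes[OF sr_ideal_content]
proof (intro Inter_greatest, clarify)
  fix P :: "'a set" and x
  assume P: "sr_prime_ideal P" and "content (f * g) \<subseteq> P"
  then have "content f \<subseteq> P \<or> content g \<subseteq> P"
    using assms content_subset_prime_of_mult by blast
  moreover have I: "sr_ideal P" using P by (simp add: sr_prime_ideal_def)
  ultimately have "ideal_product (content f) (content g) \<subseteq> P"
    by (intro ideal_product_subset) (blast intro: sr_ideal_mult_left sr_ideal_mult_right)+
  moreover assume "x \<in> ideal_product (content f) (content g)"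
  ultimately show "x \<in> P" by blast
qed

section \<open>Subtractivity from the content formula\<close>

lemma laurent_semiring_contains_monomial:
  assumes "\<Lambda> \<union> \<Delta> \<noteq> {}"
  obtains e :: "'i \<Rightarrow>\<^sub>0 int" where "e \<noteq> 0"
    "Poly_Mapping.single e 1 \<in> (laurent_semiring \<Lambda> \<Delta> :: ('i, 'a::comm_semiring_1) laurent_poly set)"
proof -
  have "Poly_Mapping.single i (1::int) \<noteq> 0" "Poly_Mapping.single i (- 1::int) \<noteq> 0" for i :: 'i
    by (metis lookup_single_eq lookup_zero zero_neq_one)
       (metis lookup_single_eq lookup_zero zero_neq_neg_one)
  moreover obtain i where "i \<in> \<Lambda> \<or> i \<in> \<Delta>" using assms by blast
  ultimately show thesis
    using that laurent_semiring.X[of i \<Lambda> \<Delta>] laurent_semiring.X_inv[of i \<Delta> \<Lambda>]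
    unfolding laurent_X_def laurent_X_inv_def by metis
qed

text \<open>
  The factors are \<open>1 + X\<close> and \<open>a + b X + a X\<^sup>2\<close>, whose product involves \<open>b\<close> only through
  \<open>a + b\<close>. Any monomial \<open>X\<close> with nonzero exponent
  vector serves, so it does not matter whether the indeterminate comes from \<open>\<Lambda>\<close> or, inverted,
  from \<open>\<Delta>\<close>.
\<close>

lemma prime_subtractive_of_content_formula:
  fixes P :: "'a::comm_semiring_1 set" and \<Lambda> \<Delta> :: "'i set"
  assumes ne: "\<Lambda> \<union> \<Delta> \<noteq> {}"
    and formula: "\<And>f g :: ('i, 'a) laurent_poly.
      f \<in> laurent_semiring \<Lambda> \<Delta> \<Longrightarrow> g \<in> laurent_semiring \<Lambda> \<Delta> \<Longrightarrow>
      ideal_product (content f) (content g) \<subseteq> sr_radical (content (f * g))"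
    and P: "sr_prime_ideal P"
  shows "subtractive P"
  unfolding subtractive_def
proof (intro allI impI)
  fix a b assume ab: "a + b \<in> P \<and> a \<in> P"
  have I: "sr_ideal P" using P by (simp add: sr_prime_ideal_def)
  obtain e :: "'i \<Rightarrow>\<^sub>0 int" where e: "e \<noteq> 0"
    and X: "Poly_Mapping.single e 1 \<in> (laurent_semiring \<Lambda> \<Delta> :: ('i, 'a) laurent_poly set)"
    using laurent_semiring_contains_monomial[OF ne] by metis
  let ?X = "Poly_Mapping.single e 1 :: ('i, 'a) laurent_poly"
  define f where "f = laurent_const 1 + ?X"
  define g where "g = laurent_const a + laurent_const b * ?X + laurent_const a * (?X * ?X)"
  have "f \<in> laurent_semiring \<Lambda> \<Delta>" "g \<in> laurent_semiring \<Lambda> \<Delta>"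
    unfolding f_def g_def using X
    by (auto intro!: laurent_semiring.add laurent_semiring.mult laurent_semiring.const)
  note formula = formula[OF this]
  have "e + e \<noteq> e" using e by simp
  have "Poly_Mapping.lookup f 0 = 1"
    using e by (simp add: f_def laurent_const_def lookup_add lookup_single)
  moreover have "Poly_Mapping.lookup g e = b"
    using e \<open>e + e \<noteq> e\<close>
    by (simp add: g_def laurent_const_def lookup_add lookup_single mult_single)
  ultimately have "1 * b \<in> ideal_product (content f) (content g)"
    using lookup_in_content[of f 0] lookup_in_content[of g e] by (metis mult_in_ideal_product)
  moreover have "content (f * g) \<subseteq> P"
  proof -
    have "f * g = Poly_Mapping.single 0 a + Poly_Mapping.single e (a + b)
        + Poly_Mapping.single (e + e) (a + b) + Poly_Mapping.single (e + e + e) a"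
      by (simp add: f_def g_def laurent_const_def mult_single single_add algebra_simps)
    moreover have "Poly_Mapping.lookup (Poly_Mapping.single k s) l \<in> P" if "s \<in> P" for s and k l :: "'i \<Rightarrow>\<^sub>0 int"
      using that sr_ideal_zero[OF I] by (simp add: lookup_single when_def)
    ultimately show ?thesis
      unfolding content_subset_iff[OF I] using ab I by (auto simp: lookup_add intro!: sr_ideal_add)
  qed
  ultimately show "b \<in> P"
    using formula sr_radical_subset_prime[OF P, of "content (f * g)"] by auto
qed

theorem theorem40:
  fixes \<Lambda> \<Delta> :: "'i set"
  assumes "\<Lambda> \<union> \<Delta> \<noteq> {}"
  shows
    "((\<forall>f \<in> (laurent_semiring \<Lambda> \<Delta> :: ('i, 'a) laurent_poly set). \<forall>g \<in> laurent_semiring \<Lambda> \<Delta>.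
         content (f * g) \<subseteq> ideal_product (content f) (content g) \<and>
         ideal_product (content f) (content g) \<subseteq> sr_radical (content (f * g)))
       \<longleftrightarrow> (\<forall>I :: 'a::comm_semiring_1 set. sr_ideal I \<longrightarrow> subtractive (sr_radical I)))
     \<and> ((\<forall>I :: 'a set. sr_ideal I \<longrightarrow> subtractive (sr_radical I))
       \<longleftrightarrow> (\<forall>P :: 'a set. sr_prime_ideal P \<longrightarrow> subtractive P))"
  unfolding radicals_subtractive_iff_primes_subtractive
proof (intro conjI iffI ballI)
  assume formula: "\<forall>f \<in> (laurent_semiring \<Lambda> \<Delta> :: ('i, 'a) laurent_poly set).
    \<forall>g \<in> laurent_semiring \<Lambda> \<Delta>.
      content (f * g) \<subseteq> ideal_product (content f) (content g) \<and>
      ideal_product (content f) (content g) \<subseteq> sr_radical (content (f * g))"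
  show "\<forall>P :: 'a set. sr_prime_ideal P \<longrightarrow> subtractive P"
  proof (intro allI impI)
    fix P :: "'a set" assume "sr_prime_ideal P"
    then show "subtractive P"
      using formula by (intro prime_subtractive_of_content_formula[OF assms]) simp_all
  qed
next
  fix f g :: "('i, 'a) laurent_poly"
  assume "\<forall>P :: 'a set. sr_prime_ideal P \<longrightarrow> subtractive P"
  then show "ideal_product (content f) (content g) \<subseteq> sr_radical (content (f * g))"
    by (intro ideal_product_content_subset_radical) simp
qed (rule content_mult_subset)

end
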